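(* Consider the piecewise linear system $$ \left\{\begin{array}{l}\dot x=T_Lx-y\\ \dot y=D_Lx-a_L\end{array}\right.\ \text{for } x<0,\qquad \left\{\begin{array}{l}\dot x=T_Rx-y+b\\ \dot y=D_Rx-a_R\end{array}\right.\ \text{for } x>0, $$ with $T_L,D_L,a_L,T_R,D_R,a_R,b\in\mathbb{R}$, $a_L^2+D_L^2\neq0$ and $a_R^2+D_R^2\neq0$. If $T_LT_R>0$, then the system has at most two limit cycles.
   Context: Let $\Sigma=\{(x,y)\in\mathbb{R}^2:x=0\}$. A crossing periodic orbit of the piecewise linear system is a closed orbit formed by an arc of the left system contained in $x<0$ going from $(0,y_0)$ to $(0,y_1)$ and an arc of the right system contained in $x>0$ going from $(0,y_1)$ to $(0,y_0)$, where $y_0>\max\{0,b\}$ and $y_1<\min\{0,b\}$ (both vector fields cross $\Sigma$ transversally in the same direction at these points). A limit cycle means an isolated crossing periodic orbit, i.e. a crossing periodic orbit having a neighbourhood that contains no other crossing periodic orbit. *)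

theory Defs
  imports "HOL-Analysis.Analysis"
begin

definition left_field :: "real \<Rightarrow> real \<Rightarrow> real \<Rightarrow> real \<times> real \<Rightarrow> real \<times> real" where
  "left_field T D a p = (T * fst p - snd p, D * fst p - a)"

definition right_field :: "real \<Rightarrow> real \<Rightarrow> real \<Rightarrow> real \<Rightarrow> real \<times> real \<Rightarrow> real \<times> real" where
  "right_field T D a b p = (T * fst p - snd p + b, D * fst p - a)"

text \<open>
  \<open>orbit_arc F H p q A\<close>: the set \<open>A\<close> is a compact arc of a trajectory of the vector field \<open>F\<close>,
  travelled in positive time from \<open>p\<close> to \<open>q\<close>, lying in \<open>H\<close> except possibly for its two endpoints.
  Derivatives at the two endpoints of the time interval are one-sided.
\<close>

definition orbit_arc ::
  "(real \<times> real \<Rightarrow> real \<times> real) \<Rightarrow> (real \<times> real) set \<Rightarrow> real \<times> real \<Rightarrow> real \<times> real \<Rightarrow>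
    (real \<times> real) set \<Rightarrow> bool" where
  "orbit_arc F H p q A \<longleftrightarrow>
    (\<exists>(\<phi> :: real \<Rightarrow> real \<times> real) \<tau>. \<tau> > 0 \<and>
      (\<forall>t\<in>{0..\<tau>}. (\<phi> has_vector_derivative F (\<phi> t)) (at t within {0..\<tau>})) \<and>
      \<phi> 0 = p \<and> \<phi> \<tau> = q \<and> (\<forall>t\<in>{0<..<\<tau>}. \<phi> t \<in> H) \<and>
      A = \<phi> ` {0..\<tau>})"

text \<open>
  A periodic orbit is identified with its trace in the plane. On the line \<open>x = 0\<close> the horizontal
  velocities of the two fields are \<open>- y\<close> and \<open>b - y\<close>; the inequalities on \<open>y0\<close> and \<open>y1\<close> say
  that both are negative at \<open>(0, y0)\<close> and both are positive at \<open>(0, y1)\<close>.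
\<close>

definition crossing_periodic_orbit ::
  "real \<Rightarrow> real \<Rightarrow> real \<Rightarrow> real \<Rightarrow> real \<Rightarrow> real \<Rightarrow> real \<Rightarrow> (real \<times> real) set \<Rightarrow> bool" where
  "crossing_periodic_orbit TL DL aL TR DR aR b C \<longleftrightarrow>
    (\<exists>y0 y1 A B. y0 > max 0 b \<and> y1 < min 0 b \<and>
      orbit_arc (left_field TL DL aL) {p. fst p < 0} (0, y0) (0, y1) A \<and>
      orbit_arc (right_field TR DR aR b) {p. fst p > 0} (0, y1) (0, y0) B \<and>
      C = A \<union> B)"

definition limit_cycle ::
  "real \<Rightarrow> real \<Rightarrow> real \<Rightarrow> real \<Rightarrow> real \<Rightarrow> real \<Rightarrow> real \<Rightarrow> (real \<times> real) set \<Rightarrow> bool" where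
  "limit_cycle TL DL aL TR DR aR b C \<longleftrightarrow>
    crossing_periodic_orbit TL DL aL TR DR aR b C \<and>
    (\<exists>U. open U \<and> C \<subseteq> U \<and>
      (\<forall>C'. crossing_periodic_orbit TL DL aL TR DR aR b C' \<and> C' \<subseteq> U \<longrightarrow> C' = C))"

end

theory Submission imports Defs begin

text \<open>
  Let \<open>s\<close> solve \<open>s'' = T s' - D s\<close> with \<open>s(0) = 0\<close>, \<open>s'(0) = 1\<close>, and put \<open>r' = s\<close>, \<open>r(0) = 0\<close>,
  \<open>h = s\<^sup>2 - r s'\<close>. For \<open>a \<noteq> 0\<close> a left arc from \<open>(0, y0)\<close> to \<open>(0, y1)\<close> with travelling time \<open>t\<close>
  satisfies \<open>y0 = a r / s\<close> and \<open>y1 = - a h / s\<close> at \<open>t\<close>. Hence the half-return map has the slope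
  \<open>dy1/dy0 = - r exp (T t) / h\<close>, whose derivative in \<open>t\<close> is \<open>- exp (T t) s (h - r) / h\<^sup>2\<close>. Since
  \<open>s\<close> has the sign of \<open>a\<close> and \<open>h - r\<close> the sign of \<open>T\<close>, the map is strictly convex for \<open>T < 0\<close> and
  strictly concave for \<open>T > 0\<close>. The point reflection \<open>(x, y) \<mapsto> (-x, b - y)\<close> turns right arcs into left
  arcs and reverses the convexity, so for \<open>TL TR > 0\<close> the graphs of the two half-return maps meet at
  most twice. For \<open>a = 0\<close> the map is linear, \<open>y1 = - k y0\<close> with \<open>T (k - 1) > 0\<close>.
\<close>

definition half_return :: "real \<Rightarrow> real \<Rightarrow> real \<Rightarrow> real \<Rightarrow> real \<Rightarrow> (real \<times> real) set \<Rightarrow> bool" where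
  "half_return T D a y0 y1 A \<longleftrightarrow> 0 < y0 \<and> y1 < 0 \<and>
    orbit_arc (left_field T D a) {p. fst p < 0} (0, y0) (0, y1) A"

section \<open>The scalar equation behind the left system\<close>

text \<open>The solution stays abstract, so that real, double and complex eigenvalues are treated at
  once.\<close>

locale second_order_response =
  fixes T D :: real and s s' r :: "real \<Rightarrow> real"
  assumes s_deriv: "\<And>t. (s has_real_derivative s' t) (at t)"
    and s'_deriv: "\<And>t. (s' has_real_derivative T * s' t - D * s t) (at t)"
    and r_deriv: "\<And>t. (r has_real_derivative s t) (at t)"
    and init [simp]: "s 0 = 0" "s' 0 = 1" "r 0 = 0"
begin

text \<open>By \<open>h_deriv\<close> and \<open>h_0\<close>, \<open>h t\<close> is
  \<open>exp (T t)\<close> times the integral of \<open>exp (- T u) s u\<close> over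
  \<open>0..t\<close>, which is \<open>exp (T t) r (- t)\<close>: up to that factor,
  \<open>h\<close> is \<open>r\<close> in reversed time.\<close>

definition h :: "real \<Rightarrow> real" where
  "h t = (s t)\<^sup>2 - r t * s' t"

lemma derivs_within [derivative_intros]:
  "(s has_real_derivative s' t) (at t within A)"
  "(s' has_real_derivative T * s' t - D * s t) (at t within A)"
  "(r has_real_derivative s t) (at t within A)"
  using s_deriv s'_deriv r_deriv by (auto intro: has_field_derivative_at_within)

text \<open>The second-order equation integrated once.\<close>

lemma s'_eq: "s' t = T * s t - D * r t + 1"
proof -
  let ?f = "\<lambda>t. s' t - T * s t + D * r t"
  have "(?f has_real_derivative 0) (at t)" for t
    by (auto intro!: derivative_eq_intros)
  then have "?f t = ?f 0"
    by (intro DERIV_isconst_all) auto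
  then show ?thesis by simp
qed

text \<open>Liouville's formula: the left side is \<open>s'^2 - s s''\<close>, the determinant of
  the fundamental matrix of a linear system with trace \<open>T\<close>.\<close>

lemma wronskian: "(s' t)\<^sup>2 - T * s t * s' t + D * (s t)\<^sup>2 = exp (T * t)"
proof -
  let ?f = "\<lambda>t. exp (- (T * t)) * ((s' t)\<^sup>2 - T * s t * s' t + D * (s t)\<^sup>2)"
  have "(?f has_real_derivative 0) (at t)" for t
    by (rule derivative_eq_intros refl)+ (simp add: algebra_simps power2_eq_square)
  then have "?f t = ?f 0"
    by (intro DERIV_isconst_all) auto
  then show ?thesis by (simp add: exp_minus field_simps)
qed

lemma h_deriv: "(h has_real_derivative s t + T * h t) (at t within A)"
proof -
  have "(h has_real_derivative 2 * s t * s' t - (s t * s' t + r t * (T * s' t - D * s t)))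
      (at t within A)"
    unfolding h_def by (auto intro!: derivative_eq_intros)
  moreover have "2 * s t * s' t - (s t * s' t + r t * (T * s' t - D * s t)) = s t + T * h t"
    unfolding h_def by (subst s'_eq[of t])+ (simp add: algebra_simps power2_eq_square)
  ultimately show ?thesis by simp
qed

lemma h_0 [simp]: "h 0 = 0"
  by (simp add: h_def)

lemma exp_h_deriv:
  "((\<lambda>t. exp (- (T * t)) * h t) has_real_derivative exp (- (T * t)) * s t) (at t within A)"
  by (rule derivative_eq_intros h_deriv refl)+ (simp add: algebra_simps)

lemma cont: "continuous_on A s" "continuous_on A r" "continuous_on A h"
  by (auto intro!: has_real_derivative_imp_continuous_on derivs_within h_deriv)

text \<open>The inverse fundamental matrix applied to a solution is constant; \<open>?f\<close> and
  \<open>?g\<close> are its two components.\<close>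

lemma homogeneous_unique:
  assumes u: "\<And>t. t \<in> {0..\<tau>} \<Longrightarrow> (u has_real_derivative T * u t - v t) (at t within {0..\<tau>})"
    and v: "\<And>t. t \<in> {0..\<tau>} \<Longrightarrow> (v has_real_derivative D * u t) (at t within {0..\<tau>})"
    and zero: "u 0 = 0" "v 0 = 0" and t: "t \<in> {0..\<tau>}"
  shows "u t = 0 \<and> v t = 0"
proof -
  let ?f = "\<lambda>t. exp (- (T * t)) * ((s' t - T * s t) * u t + s t * v t)"
  let ?g = "\<lambda>t. exp (- (T * t)) * (s' t * v t - D * s t * u t)"
  have "(?f has_real_derivative 0) (at t within {0..\<tau>})" if "t \<in> {0..\<tau>}" for t
    by (rule derivative_eq_intros u v that refl)+ (simp add: algebra_simps)
  then obtain cf where cf: "\<And>t. t \<in> {0..\<tau>} \<Longrightarrow> ?f t = cf"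
    using has_field_derivative_zero_constant[of "{0..\<tau>}" ?f] by auto
  have "(?g has_real_derivative 0) (at t within {0..\<tau>})" if "t \<in> {0..\<tau>}" for t
    by (rule derivative_eq_intros u v that refl)+ (simp add: algebra_simps)
  then obtain cg where cg: "\<And>t. t \<in> {0..\<tau>} \<Longrightarrow> ?g t = cg"
    using has_field_derivative_zero_constant[of "{0..\<tau>}" ?g] by auto
  have 0: "0 \<in> {0..\<tau>}" using t by auto
  have f: "(s' t - T * s t) * u t + s t * v t = 0" and g: "s' t * v t - D * s t * u t = 0"
    using cf[OF t] cf[OF 0] cg[OF t] cg[OF 0] zero by auto
  \<comment> \<open>Multiplying back by the fundamental matrix recovers \<open>u\<close> and
    \<open>v\<close>; \<open>wronskian\<close> evaluates the determinant.\<close>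
  have "exp (T * t) * u t = s' t * ((s' t - T * s t) * u t + s t * v t)
      - s t * (s' t * v t - D * s t * u t)"
    unfolding wronskian[symmetric] by (simp add: algebra_simps power2_eq_square)
  moreover have "exp (T * t) * v t = D * s t * ((s' t - T * s t) * u t + s t * v t)
      + (s' t - T * s t) * (s' t * v t - D * s t * u t)"
    unfolding wronskian[symmetric] by (simp add: algebra_simps power2_eq_square)
  ultimately show ?thesis unfolding f g by simp
qed

section \<open>Left arcs in terms of \<open>s\<close>, \<open>r\<close> and \<open>h\<close>\<close>

text \<open>The explicit solution of the left system starting at \<open>(0, y)\<close>.\<close>

definition flow :: "real \<Rightarrow> real \<Rightarrow> real \<Rightarrow> real \<times> real" where
  "flow a y t = (a * r t - y * s t, y * (s' t - T * s t) + a * (T * r t - s t))"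

text \<open>The inequality says \<open>x < 0\<close> inside the arc. The end point is given as minus
  the horizontal velocity \<open>a s - y0 s'\<close>, which equals the second coordinate on the line
  \<open>x = 0\<close>.\<close>

definition returns :: "real \<Rightarrow> real \<Rightarrow> real \<Rightarrow> real \<Rightarrow> bool" where
  "returns a y0 y1 \<tau> \<longleftrightarrow> 0 < \<tau> \<and> 0 < y0 \<and> y1 < 0 \<and> (\<forall>t\<in>{0<..<\<tau>}. a * r t < y0 * s t) \<and>
    y0 * s \<tau> = a * r \<tau> \<and> y1 = y0 * s' \<tau> - a * s \<tau>"

lemma half_return_returns:
  assumes "half_return T D a y0 y1 A"
  obtains \<tau> where "returns a y0 y1 \<tau>" "A = flow a y0 ` {0..\<tau>}"
proof -
  obtain \<phi> \<tau> where \<tau>: "\<tau> > 0"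
    and d: "\<And>t. t \<in> {0..\<tau>} \<Longrightarrow>
      (\<phi> has_vector_derivative left_field T D a (\<phi> t)) (at t within {0..\<tau>})"
    and ends: "\<phi> 0 = (0, y0)" "\<phi> \<tau> = (0, y1)"
    and neg: "\<And>t. t \<in> {0<..<\<tau>} \<Longrightarrow> fst (\<phi> t) < 0"
    and A: "A = \<phi> ` {0..\<tau>}"
    using assms unfolding half_return_def orbit_arc_def mem_Collect_eq by blast
  have d1: "((\<lambda>t. fst (\<phi> t)) has_real_derivative T * fst (\<phi> t) - snd (\<phi> t)) (at t within {0..\<tau>})"
    and d2: "((\<lambda>t. snd (\<phi> t)) has_real_derivative D * fst (\<phi> t) - a) (at t within {0..\<tau>})"
    if "t \<in> {0..\<tau>}" for t
    using bounded_linear.has_vector_derivative[OF bounded_linear_fst d[OF that]]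
      bounded_linear.has_vector_derivative[OF bounded_linear_snd d[OF that]]
    by (auto simp: left_field_def has_real_derivative_iff_has_vector_derivative)
  have eq: "\<phi> t = flow a y0 t" if "t \<in> {0..\<tau>}" for t
  proof -
    \<comment> \<open>The difference of two solutions with the same initial point solves the
      homogeneous system with zero data.\<close>
    let ?u = "\<lambda>t. fst (\<phi> t) - (a * r t - y0 * s t)"
    let ?v = "\<lambda>t. snd (\<phi> t) - (y0 * (s' t - T * s t) + a * (T * r t - s t))"
    have "?u t = 0 \<and> ?v t = 0"
    proof (rule homogeneous_unique[where u = ?u and v = ?v, OF _ _ _ _ that])
      fix t assume t: "t \<in> {0..\<tau>}"
      show "(?u has_real_derivative T * ?u t - ?v t) (at t within {0..\<tau>})"
        by (rule derivative_eq_intros d1 d2 t refl)+ (simp add: algebra_simps)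
      show "(?v has_real_derivative D * ?u t) (at t within {0..\<tau>})"
        by (rule derivative_eq_intros d1 d2 t refl)+ (simp add: s'_eq[of t] algebra_simps)
    qed (auto simp: ends)
    then show ?thesis by (simp add: flow_def prod_eq_iff)
  qed
  have "\<forall>t\<in>{0<..<\<tau>}. a * r t < y0 * s t"
    using neg eq by (force simp: flow_def)
  moreover have "y0 * s \<tau> = a * r \<tau> \<and> y1 = y0 * s' \<tau> - a * s \<tau>"
  proof -
    have "flow a y0 \<tau> = (0, y1)" using eq[of \<tau>] \<tau> ends by simp
    then have *: "a * r \<tau> - y0 * s \<tau> = 0" "y1 = y0 * (s' \<tau> - T * s \<tau>) + a * (T * r \<tau> - s \<tau>)"
      by (auto simp: flow_def)
    have "y1 = y0 * s' \<tau> - a * s \<tau> + T * (a * r \<tau> - y0 * s \<tau>)"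
      unfolding *(2) by (simp add: algebra_simps)
    then show ?thesis using *(1) by simp
  qed
  moreover have "A = flow a y0 ` {0..\<tau>}"
    unfolding A using eq by (intro image_cong) auto
  ultimately show thesis using that \<tau> assms by (auto simp: returns_def half_return_def)
qed

lemma returns_unique:
  assumes "returns a y0 y1 \<tau>" "returns a y0 z1 \<sigma>"
  shows "\<tau> = \<sigma>"
  using assms unfolding returns_def
  by (metis greaterThanLessThan_iff less_irrefl linorder_neqE_linordered_idom)

text \<open>The graph of the half-return map, parametrised by the return time. The form without
  quotients also covers \<open>a = 0\<close>, where \<open>s\<close> vanishes at the return.\<close>

lemma returns_curve:
  assumes "returns a y0 y1 \<tau>"
  shows "y0 * s \<tau> = a * r \<tau>" "y1 * s \<tau> = - (a * h \<tau>)"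
proof -
  show *: "y0 * s \<tau> = a * r \<tau>" using assms by (simp add: returns_def)
  have "y1 = y0 * s' \<tau> - a * s \<tau>" using assms by (simp add: returns_def)
  then have "y1 * s \<tau> = y0 * s \<tau> * s' \<tau> - a * (s \<tau>)\<^sup>2"
    by algebra
  then show "y1 * s \<tau> = - (a * h \<tau>)" unfolding * h_def by (simp add: algebra_simps)
qed

section \<open>Signs of \<open>s\<close>, \<open>r\<close> and \<open>h\<close> along an arc\<close>

lemma first_zero:
  assumes "0 < t" "s t \<le> 0"
  obtains c where "0 < c" "c \<le> t" "s c = 0" "\<And>u. 0 < u \<Longrightarrow> u < c \<Longrightarrow> 0 < s u"
proof -
  obtain e where e: "e > 0" "\<And>u. 0 < u \<Longrightarrow> u < e \<Longrightarrow> 0 < s u"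
    using DERIV_pos_inc_right[OF s_deriv[of 0]] by auto
  \<comment> \<open>Starting at \<open>e/2\<close> keeps the zero of \<open>s\<close> at the origin
    out of this compact set, whose minimum is the required zero.\<close>
  let ?Z = "{u \<in> {e/2..t}. s u \<le> 0}"
  have "closed ?Z"
    by (rule continuous_on_closed_Collect_le[OF cont(1) continuous_on_const closed_atLeastAtMost])
  moreover have "bounded ?Z"
    by (rule bounded_subset[OF bounded_closed_interval[of "e/2" t]]) auto
  ultimately have "compact ?Z" by (simp add: compact_eq_bounded_closed)
  moreover have "e / 2 \<le> t" using e assms by (cases "t < e") force+
  then have "t \<in> ?Z" using assms by simp
  ultimately obtain c where c: "c \<in> ?Z" "\<And>u. u \<in> ?Z \<Longrightarrow> c \<le> u"
    using compact_attains_inf[of ?Z] by blast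
  have pos: "0 < s u" if "0 < u" "u < c" for u
  proof (cases "u < e / 2")
    case True
    then show ?thesis using e(1) e(2)[OF that(1)] by simp
  next
    case False
    then have "u \<in> ?Z" if "s u \<le> 0" using that c(1) \<open>u < c\<close> by auto
    then show ?thesis using c(2)[of u] \<open>u < c\<close> by fastforce
  qed
  have "0 \<le> s c"
  proof (rule ccontr)
    assume "\<not> 0 \<le> s c"
    moreover have "0 < s (e/2)" using e by auto
    moreover have "e/2 \<le> c" using c by auto
    ultimately obtain u where "e/2 \<le> u" "u \<le> c" "s u = 0"
      using IVT2'[of s c 0 "e/2"] cont(1) by (metis less_eq_real_def not_le)
    then show False using pos[of u] e(1) \<open>\<not> 0 \<le> s c\<close> by (cases "u = c") auto
  qed
  then show thesis using that[of c] c(1) e(1) pos by auto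
qed

text \<open>Both \<open>r\<close> and \<open>exp (- T t) h\<close> start at 0 and have a derivative
  with the sign of \<open>s\<close>.\<close>

lemma r_h_pos:
  assumes "0 < c" "\<And>u. 0 < u \<Longrightarrow> u < c \<Longrightarrow> 0 < s u"
  shows "0 < r c" "0 < h c"
proof -
  have "r 0 < r c"
    by (rule DERIV_pos_imp_increasing_open[OF assms(1)]) (use assms(2) r_deriv cont in auto)
  then show "0 < r c" by simp
  have "exp (- (T * 0)) * h 0 < exp (- (T * c)) * h c"
  proof (rule DERIV_pos_imp_increasing_open[OF assms(1)])
    fix u assume "0 < u" "u < c"
    then have "0 < exp (- (T * u)) * s u" using assms(2) by simp
    then show "\<exists>y. ((\<lambda>t. exp (- (T * t)) * h t) has_real_derivative y) (at u) \<and> 0 < y"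
      using exp_h_deriv by blast
  qed (intro continuous_intros cont)
  then show "0 < h c" by (simp add: zero_less_mult_iff)
qed

text \<open>At a first zero \<open>c\<close> of \<open>s\<close> the position would be
  \<open>x = a r c > 0\<close>, whereas \<open>x \<le> 0\<close> on the whole arc.\<close>

lemma s_pos:
  assumes "returns a y0 y1 \<tau>" "0 < a" "0 < t" "t \<le> \<tau>"
  shows "0 < s t"
proof (rule ccontr)
  assume "\<not> 0 < s t"
  then obtain c where c: "0 < c" "c \<le> t" "s c = 0" "\<And>u. 0 < u \<Longrightarrow> u < c \<Longrightarrow> 0 < s u"
    using first_zero[of t] assms by (metis not_le)
  then have "0 < a * r c" using r_h_pos(1) assms(2) by simp
  then show False using assms(1,4) c(1-3)
    by (cases "c = \<tau>") (auto simp: returns_def dest!: bspec[where x = c])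
qed

lemma returns_zero:
  assumes "returns 0 y0 y1 \<tau>"
  shows "s \<tau> = 0" "\<And>t. 0 < t \<Longrightarrow> t < \<tau> \<Longrightarrow> 0 < s t" "y1 = y0 * s' \<tau>"
  using assms by (auto simp: returns_def zero_less_mult_iff)

text \<open>After a zero \<open>c\<close> the shifted function solves the same equation with initial
  data \<open>0\<close> and \<open>s' c\<close>, so it is a multiple of \<open>s\<close>. The
  function \<open>?v\<close> is \<open>T u - u'\<close>, which makes \<open>(?u, ?v)\<close> a
  solution of the first-order system.\<close>

lemma s_shift:
  assumes "s c = 0" "0 \<le> t"
  shows "s (c + t) = s' c * s t" "s' (c + t) = s' c * s' t"
proof -
  let ?u = "\<lambda>t. s (c + t) - s' c * s t"
  let ?v = "\<lambda>t. T * (s (c + t) - s' c * s t) - (s' (c + t) - s' c * s' t)"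
  have shift: "(s has_real_derivative s' (c + t)) (at (c + t))"
    "(s' has_real_derivative T * s' (c + t) - D * s (c + t)) (at (c + t))" for t
    by (rule s_deriv s'_deriv)+
  have g: "((\<lambda>t. c + t) has_real_derivative 1) (at t within A)" for t A
    by (auto intro!: derivative_eq_intros)
  have [derivative_intros]: "((\<lambda>t. s (c + t)) has_real_derivative s' (c + t)) (at t within A)"
    "((\<lambda>t. s' (c + t)) has_real_derivative T * s' (c + t) - D * s (c + t)) (at t within A)" for t A
    using DERIV_chain2[where g = "\<lambda>t. c + t", OF shift(1) g]
      DERIV_chain2[where g = "\<lambda>t. c + t", OF shift(2) g] by simp_all
  have "?u t = 0 \<and> ?v t = 0"
  proof (rule homogeneous_unique[where u = ?u and v = ?v and \<tau> = t])
    fix t' assume "t' \<in> {0..t}"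
    show "(?u has_real_derivative T * ?u t' - ?v t') (at t' within {0..t})"
      by (rule derivative_eq_intros refl)+ (simp add: algebra_simps)
    show "(?v has_real_derivative D * ?u t') (at t' within {0..t})"
      by (rule derivative_eq_intros refl)+ (simp add: algebra_simps)
  qed (use assms in auto)
  then show "s (c + t) = s' c * s t" "s' (c + t) = s' c * s' t" by auto
qed

text \<open>
  For \<open>a < 0\<close> the orbit must return before the second zero \<open>2 c\<close> of \<open>s\<close>: after time \<open>2 c\<close> it has
  made one full turn, contracted or expanded by the factor \<open>\<kappa>\<^sup>2\<close>. If \<open>\<kappa> > 1\<close>, it has already
  crossed the line, and if \<open>\<kappa> \<le> 1\<close>, it can never return afterwards.
\<close>

lemma s_neg:
  assumes ret: "returns a y0 y1 \<tau>" and a: "a < 0"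
  obtains c where "0 < c" "c < \<tau>" "s c = 0" "\<And>t. 0 < t \<Longrightarrow> t < c \<Longrightarrow> 0 < s t"
    "\<And>t. c < t \<Longrightarrow> t \<le> \<tau> \<Longrightarrow> s t < 0"
proof -
  have \<tau>: "0 < \<tau>" and y: "0 < y0" "y1 < 0" and y0s: "y0 * s \<tau> = a * r \<tau>"
    and y1: "y1 = y0 * s' \<tau> - a * s \<tau>"
    and below: "\<And>t. 0 < t \<Longrightarrow> t < \<tau> \<Longrightarrow> a * r t < y0 * s t"
    using ret by (auto simp: returns_def)
  have "\<exists>t. 0 < t \<and> t \<le> \<tau> \<and> s t \<le> 0"
  proof (rule ccontr)
    assume "\<not> ?thesis"
    then have "\<And>t. 0 < t \<Longrightarrow> t \<le> \<tau> \<Longrightarrow> 0 < s t" by force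
    moreover from this have "0 < r \<tau>" using r_h_pos(1)[of \<tau>] \<tau> by auto
    ultimately have "0 < y0 * s \<tau>" "a * r \<tau> < 0" using y \<tau> a by (auto simp: mult_less_0_iff)
    then show False using y0s by simp
  qed
  then obtain c where c: "0 < c" "c \<le> \<tau>" "s c = 0" and pos: "\<And>t. 0 < t \<Longrightarrow> t < c \<Longrightarrow> 0 < s t"
    using first_zero by (metis order_trans)
  have rc: "0 < r c" using r_h_pos(1) c(1) pos by auto
  have hc: "0 < h c" using r_h_pos(2) c(1) pos by auto
  have "c \<noteq> \<tau>" using rc a y0s c(3) by auto
  then have "c < \<tau>" using c by simp
  define \<kappa> where "\<kappa> = - s' c"
  have \<kappa>: "0 < \<kappa>" using hc rc c(3) by (simp add: h_def \<kappa>_def mult_less_0_iff)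
  have s_sh: "s (c + t) = - \<kappa> * s t" and s'_sh: "s' (c + t) = - \<kappa> * s' t" if "0 \<le> t" for t
    using s_shift[OF c(3) that] by (simp_all add: \<kappa>_def)
  \<comment> \<open>This excludes \<open>D = 0\<close>, so \<open>r\<close> can be recovered from
    \<open>s\<close> and \<open>s'\<close> by \<open>s'_eq\<close>.\<close>
  have Dr: "D * r c = 1 + \<kappa>" using s'_eq[of c] c(3) by (simp add: \<kappa>_def)
  then have D: "D \<noteq> 0" using \<kappa> by auto
  have r_sh: "r (c + t) = r c - \<kappa> * r t" if "0 \<le> t" for t
  proof -
    have "D * r (c + t) = D * (r c - \<kappa> * r t)"
      using s'_eq[of "c + t"] s'_eq[of t] Dr s_sh[OF that] s'_sh[OF that]
      by (simp add: algebra_simps)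
    then show ?thesis using D by simp
  qed
  have "\<tau> < c + c"
  proof (rule ccontr)
    assume "\<not> \<tau> < c + c"
    define u where "u = \<tau> - c - c"
    have u: "0 \<le> u" "\<tau> = c + (c + u)" "u < \<tau>"
      using \<open>\<not> \<tau> < c + c\<close> c(1) by (auto simp: u_def)
    have s\<tau>: "s \<tau> = \<kappa> * \<kappa> * s u" and s'\<tau>: "s' \<tau> = \<kappa> * \<kappa> * s' u"
      and r\<tau>: "r \<tau> = r c * (1 - \<kappa>) + \<kappa> * \<kappa> * r u"
      unfolding u(2)
      using s_sh[of "c + u"] s_sh[of u] s'_sh[of "c + u"] s'_sh[of u] r_sh[of "c + u"] r_sh[of u]
        u(1) c(1) by (simp_all add: algebra_simps)
    \<comment> \<open>The left side is the position \<open>x\<close> at time \<open>2 c\<close>. If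
      \<open>u > 0\<close>, the right side is positive because \<open>u\<close> lies inside the arc,
      but \<open>x\<close> must be negative at \<open>2 c < \<tau>\<close>.\<close>
    have key: "a * r c * (1 - \<kappa>) = \<kappa> * \<kappa> * (y0 * s u - a * r u)"
      using y0s by (simp add: s\<tau> r\<tau> algebra_simps)
    show False
    proof (cases "u = 0")
      case True
      then have "y1 = y0 * (\<kappa> * \<kappa>)" using y1 s\<tau> s'\<tau> by simp
      then show False using y \<kappa> by (simp add: mult_less_0_iff)
    next
      case False
      then have "0 < y0 * s u - a * r u" using below[of u] u by auto
      then have "0 < a * r c * (1 - \<kappa>)" using key \<kappa> by simp
      moreover have "a * r (c + c) < y0 * s (c + c)"
        using below[of "c + c"] False u c(1) by simp
      moreover have "r (c + c) = r c * (1 - \<kappa>)" "s (c + c) = 0"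
        using r_sh[of c] s_sh[of c] c by (simp_all add: algebra_simps)
      ultimately show False by simp
    qed
  qed
  then have "s t < 0" if "c < t" "t \<le> \<tau>" for t
    using s_sh[of "t - c"] pos[of "t - c"] that \<kappa> by (simp add: mult_less_0_iff zero_less_mult_iff)
  then show thesis using that c \<open>c < \<tau>\<close> pos by blast
qed

text \<open>While \<open>s > 0\<close>, \<open>r\<close> and \<open>exp (- T t) h\<close> grow from
  0. For \<open>a < 0\<close> they decrease after the zero of \<open>s\<close>, but
  \<open>returns_curve\<close> makes their final values positive.\<close>

lemma returns_r_h_pos:
  assumes ret: "returns a y0 y1 \<tau>" and t: "0 < t" "t \<le> \<tau>"
  shows "0 < r t" "0 < h t"
proof -
  have "0 < r t \<and> 0 < h t"
  proof (cases "0 \<le> a")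
    case True
    have "0 < s u" if "0 < u" "u < t" for u
      using s_pos[OF ret, of u] returns_zero(2)[of y0 y1 \<tau> u] ret True that t
      by (cases "a = 0") auto
    then show ?thesis using r_h_pos t by auto
  next
    case False
    obtain c where c: "0 < c" "c < \<tau>" "s c = 0" "\<And>t. 0 < t \<Longrightarrow> t < c \<Longrightarrow> 0 < s t"
      "\<And>t. c < t \<Longrightarrow> t \<le> \<tau> \<Longrightarrow> s t < 0"
      using s_neg[OF ret] False by (metis not_le)
    show ?thesis
    proof (cases "t \<le> c")
      case True
      then show ?thesis using r_h_pos[of t] c t by auto
    next
      case tc: False
      have sgn: "0 < y0" "y1 < 0" "s \<tau> < 0" using ret c by (auto simp: returns_def)
      have "0 < a * - r \<tau>" "0 < a * - h \<tau>"
        using returns_curve[OF ret] sgn mult_pos_neg[of y0 "s \<tau>"] mult_neg_neg[of y1 "s \<tau>"] by auto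
      then have end_pos: "0 < r \<tau>" "0 < h \<tau>"
        using False by (auto simp: zero_less_mult_iff mult_less_0_iff)
      have "r \<tau> \<le> r t"
        using tc c(5) r_deriv
        by (intro DERIV_nonpos_imp_nonincreasing[OF t(2)]) (force intro: less_imp_le)
      moreover have "exp (- (T * \<tau>)) * h \<tau> \<le> exp (- (T * t)) * h t"
      proof (rule DERIV_nonpos_imp_nonincreasing[OF t(2)])
        fix u assume "t \<le> u" "u \<le> \<tau>"
        then have "exp (- (T * u)) * s u \<le> 0"
          using tc c(5)[of u] by (simp add: mult_le_0_iff)
        then show "\<exists>y. ((\<lambda>t. exp (- (T * t)) * h t) has_real_derivative y) (at u) \<and> y \<le> 0"
          using exp_h_deriv by blast
      qed
      ultimately show ?thesis
        using end_pos by (metis exp_gt_zero less_le_trans zero_less_mult_iff not_less_iff_gr_or_eq)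
    qed
  qed
  then show "0 < r t" "0 < h t" by auto
qed

text \<open>Since \<open>h' = s + T h\<close> and \<open>r' = s\<close>, the derivative of
  \<open>T (h - r)\<close> is \<open>T^2 h\<close>.\<close>

lemma returns_h_r:
  assumes ret: "returns a y0 y1 \<tau>" and t: "0 < t" "t \<le> \<tau>" and T: "T \<noteq> 0"
  shows "0 < T * (h t - r t)"
proof -
  let ?f = "\<lambda>t. T * (h t - r t)"
  have "?f 0 < ?f t"
  proof (rule DERIV_pos_imp_increasing_open[OF t(1)])
    fix u assume u: "0 < u" "u < t"
    have "(?f has_real_derivative T * T * h u) (at u)"
      by (rule derivative_eq_intros h_deriv refl)+ (simp add: algebra_simps)
    moreover have "0 < T * T * h u"
      using returns_r_h_pos(2)[OF ret, of u] u t T by (simp add: zero_less_mult_iff linorder_neq_iff disj_commute)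
    ultimately show "\<exists>y. (?f has_real_derivative y) (at u) \<and> 0 < y" by blast
  qed (intro continuous_intros cont)
  then show ?thesis by simp
qed

text \<open>The times between two returns lie on one branch of the curve
  \<open>(a r / s, - a h / s)\<close>, with no pole in between: for \<open>a < 0\<close> all of them
  come after the first positive zero of \<open>s\<close>.\<close>

lemma s_sign:
  assumes y: "returns a y0 y1 \<tau>" and z: "returns a z0 z1 \<sigma>" and a: "a \<noteq> 0"
    and t: "\<tau> \<le> t" "t \<le> \<sigma>"
  shows "0 < a * s t"
proof (cases "0 < a")
  case True
  then show ?thesis using s_pos[OF z, of t] y t by (auto simp: returns_def)
next
  case False
  then have a: "a < 0" using a by simp
  obtain c where c: "0 < c" "c < \<tau>" "s c = 0" "\<And>t. 0 < t \<Longrightarrow> t < c \<Longrightarrow> 0 < s t"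
    using s_neg[OF y a] by metis
  obtain d where d: "0 < d" "d < \<sigma>" "s d = 0" "\<And>t. 0 < t \<Longrightarrow> t < d \<Longrightarrow> 0 < s t"
    "\<And>t. d < t \<Longrightarrow> t \<le> \<sigma> \<Longrightarrow> s t < 0"
    using s_neg[OF z a] by metis
  have "d \<le> c" using c d(4)[of c] by force
  then have "s t < 0" using d(5) c t by auto
  then show ?thesis using a by (simp add: mult_neg_neg)
qed

section \<open>Slope and bending of the half-return map\<close>

definition slope :: "real \<Rightarrow> real" where
  "slope t = - (r t * exp (T * t) / h t)"

text \<open>The two terms with factor \<open>T\<close> cancel, which leaves
  \<open>h - r\<close>.\<close>

lemma slope_deriv:
  assumes "h t \<noteq> 0"
  shows "(slope has_real_derivative - (exp (T * t) * s t * (h t - r t) / (h t)\<^sup>2)) (at t)"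
  unfolding slope_def using assms
  by - ((rule derivative_eq_intros h_deriv refl | assumption)+,
      simp add: field_simps power2_eq_square)

lemma curve_deriv:
  assumes "s t \<noteq> 0"
  shows "((\<lambda>t. a * r t / s t) has_real_derivative a * h t / (s t)\<^sup>2) (at t)"
    and "((\<lambda>t. - (a * h t / s t)) has_real_derivative - (a * r t * exp (T * t) / (s t)\<^sup>2)) (at t)"
proof -
  show "((\<lambda>t. a * r t / s t) has_real_derivative a * h t / (s t)\<^sup>2) (at t)"
    using assms by - ((rule derivative_eq_intros refl | assumption)+,
        simp add: h_def field_simps power2_eq_square)
  have "(s t + T * h t) * s t - h t * s' t = (s t)\<^sup>2 + (T * s t - s' t) * h t"
    by (simp add: algebra_simps power2_eq_square)
  \<comment> \<open>Here \<open>1 + T s - s' = D r\<close> lets \<open>r\<close> be factored out;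
    the cofactor is the quadratic form of \<open>wronskian\<close>.\<close>
  also have "\<dots> = r t * (D * (s t)\<^sup>2 - s' t * (T * s t - s' t))"
    using s'_eq[of t] unfolding h_def by algebra
  also have "\<dots> = r t * exp (T * t)"
    unfolding wronskian[symmetric] by (simp add: algebra_simps power2_eq_square)
  finally have *: "(s t + T * h t) * s t - h t * s' t = r t * exp (T * t)" .
  have "((\<lambda>t. - (a * h t / s t)) has_real_derivative
      - (a * ((s t + T * h t) * s t - h t * s' t) / (s t)\<^sup>2)) (at t)"
    using assms by - ((rule derivative_eq_intros h_deriv refl | assumption)+,
        simp add: field_simps power2_eq_square)
  then show "((\<lambda>t. - (a * h t / s t)) has_real_derivative - (a * r t * exp (T * t) / (s t)\<^sup>2)) (at t)"
    unfolding * by (simp add: mult.assoc)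
qed

text \<open>Cauchy's mean value theorem for the curve of \<open>returns_curve\<close> yields the
  slope of a chord without inverting the parametrisation. The sign holds because \<open>a\<close>
  times the first coordinate has the derivative \<open>a^2 h / s^2 > 0\<close>.\<close>

lemma chord:
  assumes y: "returns a y0 y1 \<tau>" and z: "returns a z0 z1 \<sigma>" and a: "a \<noteq> 0" and less: "\<tau> < \<sigma>"
  obtains \<xi> where "\<tau> < \<xi>" "\<xi> < \<sigma>" "z1 - y1 = slope \<xi> * (z0 - y0)" "0 < a * (z0 - y0)"
proof -
  let ?Y0 = "\<lambda>t. a * r t / s t" and ?Y1 = "\<lambda>t. - (a * h t / s t)"
  have s: "0 < a * s t" if "\<tau> \<le> t" "t \<le> \<sigma>" for t using s_sign[OF y z a that] .
  then have s0: "s t \<noteq> 0" if "\<tau> \<le> t" "t \<le> \<sigma>" for t using that by fastforce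
  have ends: "y0 = ?Y0 \<tau>" "y1 = ?Y1 \<tau>" "z0 = ?Y0 \<sigma>" "z1 = ?Y1 \<sigma>"
    using returns_curve[OF y] returns_curve[OF z] s0[of \<tau>] s0[of \<sigma>] less
    by (simp_all add: field_simps)
  have \<tau>: "0 < \<tau>" using y by (simp add: returns_def)
  note d = curve_deriv[OF s0]
  have "\<exists>\<xi>. \<tau> < \<xi> \<and> \<xi> < \<sigma> \<and> (?Y1 \<sigma> - ?Y1 \<tau>) * (a * h \<xi> / (s \<xi>)\<^sup>2)
      = (?Y0 \<sigma> - ?Y0 \<tau>) * - (a * r \<xi> * exp (T * \<xi>) / (s \<xi>)\<^sup>2)"
    by (rule GMVT'[OF less]) (auto intro!: d DERIV_isCont[OF d(1)] DERIV_isCont[OF d(2)])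
  then obtain \<xi> where \<xi>: "\<tau> < \<xi>" "\<xi> < \<sigma>"
    and eq: "(?Y1 \<sigma> - ?Y1 \<tau>) * (a * h \<xi> / (s \<xi>)\<^sup>2)
      = (?Y0 \<sigma> - ?Y0 \<tau>) * - (a * r \<xi> * exp (T * \<xi>) / (s \<xi>)\<^sup>2)"
    by blast
  have h\<xi>: "0 < h \<xi>" using returns_r_h_pos(2)[OF z] \<xi> \<tau> by auto
  have "a * (s \<xi>)\<^sup>2 * ((z1 - y1) * h \<xi> + (z0 - y0) * (r \<xi> * exp (T * \<xi>))) = 0"
    using eq s0[of \<xi>] \<xi> unfolding ends[symmetric] by (simp add: field_simps)
  then have "(z1 - y1) * h \<xi> + (z0 - y0) * (r \<xi> * exp (T * \<xi>)) = 0"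
    using a s0[of \<xi>] \<xi> by simp
  then have "z1 - y1 = slope \<xi> * (z0 - y0)"
    using h\<xi> unfolding slope_def by (simp add: field_simps)
  moreover have "a * ?Y0 \<tau> < a * ?Y0 \<sigma>"
  proof (rule DERIV_pos_imp_increasing[OF less])
    fix t assume t: "\<tau> \<le> t" "t \<le> \<sigma>"
    have "0 < (a / s t)\<^sup>2 * h t"
      using returns_r_h_pos(2)[OF z, of t] t \<tau> a s0[OF t] by simp
    then have "0 < a * (a * h t / (s t)\<^sup>2)" by (simp add: power2_eq_square)
    then show "\<exists>y. ((\<lambda>t. a * ?Y0 t) has_real_derivative y) (at t) \<and> 0 < y"
      using DERIV_cmult[OF d(1)[OF t], of a a] by blast
  qed
  then have "0 < a * (z0 - y0)" unfolding ends[symmetric] by (simp add: algebra_simps)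
  ultimately show thesis using that \<xi> by blast
qed

text \<open>The derivative of \<open>a T slope\<close> is minus the product of \<open>a s\<close>,
  \<open>T (h - r)\<close> and \<open>exp (T t) / h^2\<close>, all positive.\<close>

lemma slope_mono:
  assumes y: "returns a y0 y1 \<tau>" and z: "returns a z0 z1 \<sigma>" and a: "a \<noteq> 0" and T: "T \<noteq> 0"
    and \<xi>: "\<tau> \<le> \<xi>" "\<xi> < \<zeta>" "\<zeta> \<le> \<sigma>"
  shows "a * T * slope \<zeta> < a * T * slope \<xi>"
proof (rule DERIV_neg_imp_decreasing[OF \<xi>(2)])
  fix t assume t: "\<xi> \<le> t" "t \<le> \<zeta>"
  have t': "0 < t" "t \<le> \<sigma>" using t \<xi> y by (auto simp: returns_def)
  have h: "0 < h t" using returns_r_h_pos(2)[OF z t'] .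
  have "0 < (a * s t) * (T * (h t - r t)) * exp (T * t) / (h t)\<^sup>2"
    using s_sign[OF y z a, of t] returns_h_r[OF z t' T] h t \<xi> by simp
  then have "a * T * - (exp (T * t) * s t * (h t - r t) / (h t)\<^sup>2) < 0"
    by (simp add: algebra_simps)
  moreover have "((\<lambda>t. a * T * slope t) has_real_derivative
      a * T * - (exp (T * t) * s t * (h t - r t) / (h t)\<^sup>2)) (at t)"
    using DERIV_cmult[OF slope_deriv] h by auto
  ultimately show "\<exists>y. ((\<lambda>t. a * T * slope t) has_real_derivative y) (at t) \<and> y < 0" by blast
qed

lemma slope_neg:
  assumes "returns a y0 y1 \<tau>" "0 < t" "t \<le> \<tau>"
  shows "slope t < 0"
  using returns_r_h_pos[OF assms] by (simp add: slope_def)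

text \<open>Equal times would force equal starting points; for distinct times \<open>chord\<close>
  fixes the sign of \<open>a (z0 - y0)\<close>.\<close>

lemma returns_time_less:
  assumes y: "returns a y0 y1 \<tau>" and z: "returns a z0 z1 \<sigma>" and a: "a \<noteq> 0" and less: "y0 < z0"
  shows "if 0 < a then \<tau> < \<sigma> else \<sigma> < \<tau>"
proof -
  have "\<tau> \<noteq> \<sigma>"
  proof
    assume "\<tau> = \<sigma>"
    moreover have "s \<tau> \<noteq> 0" using s_sign[OF y y a, of \<tau>] by auto
    ultimately have "y0 = z0"
      using returns_curve(1)[OF y] returns_curve(1)[OF z] by (metis mult_cancel_right)
    then show False using less by simp
  qed
  then consider "\<tau> < \<sigma>" | "\<sigma> < \<tau>" by linarith
  then show ?thesis
  proof cases
    case 1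
    then show ?thesis using chord[OF y z a 1] less by (smt (verit) mult_nonpos_nonneg)
  next
    case 2
    then show ?thesis using chord[OF z y a 2] less by (smt (verit) mult_nonneg_nonpos)
  qed
qed

text \<open>For \<open>a = 0\<close> every arc returns at the first positive zero of
  \<open>s\<close>.\<close>

lemma returns_zero_time:
  assumes "returns 0 y0 y1 \<tau>" "returns 0 z0 z1 \<sigma>"
  shows "\<tau> = \<sigma>"
proof -
  have "0 < \<tau>" "0 < \<sigma>" using assms by (auto simp: returns_def)
  then show ?thesis
    using returns_zero(1,2)[OF assms(1)] returns_zero(1,2)[OF assms(2)]
    by (metis less_irrefl linorder_neqE_linordered_idom)
qed

lemma returns_decreasing:
  assumes y: "returns a y0 y1 \<tau>" and z: "returns a z0 z1 \<sigma>" and less: "y0 < z0"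
  shows "z1 < y1"
proof (cases "a = 0")
  case True
  then have "y1 = y0 * s' \<tau>" "z1 = z0 * s' \<tau>"
    using returns_zero(3)[of y0 y1 \<tau>] returns_zero(3)[of z0 z1 \<sigma>] returns_zero_time[of y0 y1 \<tau>]
      y z by auto
  moreover from this have "s' \<tau> < 0" using y by (auto simp: returns_def mult_less_0_iff)
  ultimately show ?thesis using less by simp
next
  case a: False
  have pos: "0 < \<tau>" "0 < \<sigma>" using y z by (auto simp: returns_def)
  show ?thesis
  proof (cases "0 < a")
    case True
    then have "\<tau> < \<sigma>" using returns_time_less[OF y z a less] by simp
    then obtain \<xi> where \<xi>: "\<tau> < \<xi>" "\<xi> < \<sigma>" "z1 - y1 = slope \<xi> * (z0 - y0)"
      using chord[OF y z a] by metis
    then have "slope \<xi> < 0" using slope_neg[OF z] pos by auto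
    then show ?thesis using \<xi>(3) less mult_neg_pos[of "slope \<xi>" "z0 - y0"] by auto
  next
    case False
    then have "\<sigma> < \<tau>" using returns_time_less[OF y z a less] by simp
    then obtain \<xi> where \<xi>: "\<sigma> < \<xi>" "\<xi> < \<tau>" "y1 - z1 = slope \<xi> * (y0 - z0)"
      using chord[OF z y a] by metis
    then have "slope \<xi> < 0" using slope_neg[OF y] pos by auto
    then show ?thesis using \<xi>(3) less mult_neg_neg[of "slope \<xi>" "y0 - z0"] by auto
  qed
qed

text \<open>The determinant is the product of the two steps in the first coordinate, which have
  equal sign, and the difference of two chord slopes.\<close>

lemma three_returns_time_ordered:
  assumes x: "returns a x0 x1 \<rho>" and y: "returns a y0 y1 \<tau>" and z: "returns a z0 z1 \<sigma>"
    and a: "a \<noteq> 0" and T: "T \<noteq> 0" and less: "\<rho> < \<tau>" "\<tau> < \<sigma>"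
  shows "a * T * ((y0 - x0) * (z1 - y1) - (y1 - x1) * (z0 - y0)) < 0"
proof -
  obtain \<xi> where \<xi>: "\<rho> < \<xi>" "\<xi> < \<tau>" "y1 - x1 = slope \<xi> * (y0 - x0)" "0 < a * (y0 - x0)"
    using chord[OF x y a less(1)] by metis
  obtain \<zeta> where \<zeta>: "\<tau> < \<zeta>" "\<zeta> < \<sigma>" "z1 - y1 = slope \<zeta> * (z0 - y0)" "0 < a * (z0 - y0)"
    using chord[OF y z a less(2)] by metis
  have "a * T * slope \<zeta> < a * T * slope \<xi>"
    using slope_mono[OF x z a T, of \<xi> \<zeta>] \<xi> \<zeta> by auto
  moreover have "0 < (y0 - x0) * (z0 - y0)"
    using \<xi>(4) \<zeta>(4) by (auto simp: zero_less_mult_iff)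
  ultimately have "(y0 - x0) * (z0 - y0) * (a * T * slope \<zeta> - a * T * slope \<xi>) < 0"
    by (simp add: mult_pos_neg)
  then show ?thesis unfolding \<xi>(3) \<zeta>(3) by (simp add: algebra_simps)
qed

lemma three_returns:
  assumes x: "returns a x0 x1 \<rho>" and y: "returns a y0 y1 \<tau>" and z: "returns a z0 z1 \<sigma>"
    and T: "T \<noteq> 0" and less: "x0 < y0" "y0 < z0"
  shows "a = 0 \<Longrightarrow> (y0 - x0) * (z1 - y1) - (y1 - x1) * (z0 - y0) = 0"
    and "a \<noteq> 0 \<Longrightarrow> T * ((y0 - x0) * (z1 - y1) - (y1 - x1) * (z0 - y0)) < 0"
proof -
  assume a: "a = 0"
  have "x1 = x0 * s' \<rho>" "y1 = y0 * s' \<rho>" "z1 = z0 * s' \<rho>"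
    using x y z unfolding a by (auto dest: returns_zero(3) returns_zero_time)
  then show "(y0 - x0) * (z1 - y1) - (y1 - x1) * (z0 - y0) = 0"
    by (simp add: algebra_simps)
next
  assume a: "a \<noteq> 0"
  show "T * ((y0 - x0) * (z1 - y1) - (y1 - x1) * (z0 - y0)) < 0"
  proof (cases "0 < a")
    case True
    then have "\<rho> < \<tau>" "\<tau> < \<sigma>"
      using returns_time_less[OF x y a less(1)] returns_time_less[OF y z a less(2)] by auto
    then show ?thesis
      using three_returns_time_ordered[OF x y z a T] True
      by (simp add: mult.assoc mult_less_0_iff)
  next
    case False
    then have "\<tau> < \<rho>" "\<sigma> < \<tau>"
      using returns_time_less[OF x y a less(1)] returns_time_less[OF y z a less(2)] by auto
    \<comment> \<open>For \<open>a < 0\<close> later times mean smaller starting points. Reversing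
      the triple flips the sign of the determinant, which compensates the sign of
      \<open>a\<close>.\<close>
    then have "a * (T * ((y0 - z0) * (x1 - y1) - (y1 - z1) * (x0 - y0))) < 0"
      using three_returns_time_ordered[OF z y x a T] by (simp add: mult.assoc)
    then have "0 < T * ((y0 - z0) * (x1 - y1) - (y1 - z1) * (x0 - y0))"
      using False by (simp add: mult_less_0_iff)
    then show ?thesis by (simp add: algebra_simps)
  qed
qed

lemma returns_zero_ratio:
  assumes y: "returns 0 y0 y1 \<tau>" and z: "returns 0 z0 z1 \<sigma>" and T: "T \<noteq> 0"
  obtains k where "0 < k" "0 < T * (k - 1)" "y1 = - k * y0" "z1 = - k * z0"
proof
  have \<tau>: "0 < \<tau>" using y by (simp add: returns_def)
  show "y1 = - (- s' \<tau>) * y0" "z1 = - (- s' \<tau>) * z0"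
    using returns_zero(3)[OF y] returns_zero(3)[OF z] returns_zero_time[OF y z] by auto
  then show "0 < - s' \<tau>" using y by (auto simp: returns_def mult_less_0_iff)
  have "0 < T * (h \<tau> - r \<tau>)" using returns_h_r[OF y \<tau> _ T] by simp
  \<comment> \<open>With \<open>s \<tau> = 0\<close>, \<open>h\<close> reduces to
    \<open>- r s'\<close>, so the sign of \<open>h - r\<close> decides whether the ratio
    \<open>- s' \<tau>\<close> exceeds 1.\<close>
  also have "\<dots> = r \<tau> * (T * (- s' \<tau> - 1))"
    using returns_zero(1)[OF y] by (simp add: h_def algebra_simps)
  finally show "0 < T * (- s' \<tau> - 1)"
    using returns_r_h_pos(1)[OF y \<tau>] by (simp add: zero_less_mult_iff)
qed

end

section \<open>Existence of the fundamental solution\<close>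

text \<open>For \<open>D \<noteq> 0\<close> the substitution \<open>s = exp (T t / 2) S\<close>
  removes the first-order term and leaves \<open>S'' = \<mu> S\<close>, solved by linear, hyperbolic
  or trigonometric functions.\<close>

lemma second_order_response_exists:
  fixes T D :: real
  assumes T: "T \<noteq> 0"
  obtains s s' r where "second_order_response T D s s' r"
proof (cases "D = 0")
  case True
  show thesis
  proof
    show "second_order_response T D (\<lambda>t. (exp (T * t) - 1) / T) (\<lambda>t. exp (T * t))
      (\<lambda>t. ((exp (T * t) - 1) / T - t) / T)"
      using T True by unfold_locales (auto intro!: derivative_eq_intros simp: field_simps)
  qed
next
  case D: False
  define \<mu> where "\<mu> = T\<^sup>2 / 4 - D"
  obtain S S' where S: "\<And>t. (S has_real_derivative S' t) (at t)"
    and S': "\<And>t. (S' has_real_derivative \<mu> * S t) (at t)" and S0: "S 0 = 0" "S' 0 = 1"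
  proof -
    define w where "w = sqrt \<bar>\<mu>\<bar>"
    have w: "w * w = \<bar>\<mu>\<bar>" by (simp add: w_def)
    consider "\<mu> = 0" | "\<mu> > 0" | "\<mu> < 0" by linarith
    then show thesis
    proof cases
      case 1
      show thesis
        by (rule that[of "\<lambda>t. t" "\<lambda>t. 1"]) (auto simp: 1 intro!: derivative_eq_intros)
    next
      case 2
      then have \<mu>: "\<mu> = w * w" and w0: "w \<noteq> 0" using w by (auto simp: w_def)
      show thesis
        by (rule that[of "\<lambda>t. sinh (w * t) / w" "\<lambda>t. cosh (w * t)"])
          (use w0 in \<open>auto simp: \<mu> intro!: derivative_eq_intros\<close>)
    next
      case 3
      then have \<mu>: "\<mu> = - (w * w)" and w0: "w \<noteq> 0" using w by (auto simp: w_def)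
      show thesis
        by (rule that[of "\<lambda>t. sin (w * t) / w" "\<lambda>t. cos (w * t)"])
          (use w0 in \<open>auto simp: \<mu> intro!: derivative_eq_intros\<close>)
    qed
  qed
  define s where "s = (\<lambda>t. exp (T / 2 * t) * S t)"
  define s' where "s' = (\<lambda>t. exp (T / 2 * t) * (S' t + T / 2 * S t))"
  have s: "(s has_real_derivative s' t) (at t)" for t
    unfolding s_def s'_def by (rule derivative_eq_intros S refl)+ (simp add: algebra_simps)
  have s': "(s' has_real_derivative T * s' t - D * s t) (at t)" for t
    unfolding s_def s'_def
    by (rule derivative_eq_intros S S' refl)+ (simp add: \<mu>_def field_simps power2_eq_square)
  show thesis
  proof
    \<comment> \<open>The formula for \<open>r\<close> is \<open>s'_eq\<close> solved for
      \<open>r\<close>.\<close>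
    show "second_order_response T D s s' (\<lambda>t. (T * s t - s' t + 1) / D)"
    proof
      show "((\<lambda>t. (T * s t - s' t + 1) / D) has_real_derivative s t) (at t)" for t
        using D by (auto intro!: derivative_eq_intros s s')
    qed (simp_all add: s s', simp_all add: s_def s'_def S0)
  qed
qed

section \<open>The half-return map independently of the fundamental solution\<close>

lemma half_return_unique:
  assumes "T \<noteq> 0" "half_return T D a y0 y1 A" "half_return T D a y0 z1 B"
  shows "y1 = z1" "A = B"
proof -
  obtain s s' r where "second_order_response T D s s' r"
    using second_order_response_exists[OF assms(1)] .
  then interpret second_order_response T D s s' r .
  obtain \<tau> where \<tau>: "returns a y0 y1 \<tau>" "A = flow a y0 ` {0..\<tau>}"
    using half_return_returns[OF assms(2)] .
  obtain \<sigma> where \<sigma>: "returns a y0 z1 \<sigma>" "B = flow a y0 ` {0..\<sigma>}"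
    using half_return_returns[OF assms(3)] .
  have "\<tau> = \<sigma>" using returns_unique[OF \<tau>(1) \<sigma>(1)] .
  then show "A = B" using \<tau>(2) \<sigma>(2) by simp
  show "y1 = z1" using \<tau>(1) \<sigma>(1) \<open>\<tau> = \<sigma>\<close> unfolding returns_def by presburger
qed

lemma half_return_decreasing:
  assumes "T \<noteq> 0" "half_return T D a y0 y1 A" "half_return T D a z0 z1 B" "y0 < z0"
  shows "z1 < y1"
proof -
  obtain s s' r where "second_order_response T D s s' r"
    using second_order_response_exists[OF assms(1)] .
  then interpret second_order_response T D s s' r .
  show ?thesis
    by (rule half_return_returns[OF assms(2)], rule half_return_returns[OF assms(3)])
      (rule returns_decreasing[OF _ _ assms(4)])
qed

lemma half_return_three:
  assumes "T \<noteq> 0" and x: "half_return T D a x0 x1 A" and y: "half_return T D a y0 y1 B"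
    and z: "half_return T D a z0 z1 C" and less: "x0 < y0" "y0 < z0"
  shows "a = 0 \<Longrightarrow> (y0 - x0) * (z1 - y1) - (y1 - x1) * (z0 - y0) = 0"
    and "a \<noteq> 0 \<Longrightarrow> T * ((y0 - x0) * (z1 - y1) - (y1 - x1) * (z0 - y0)) < 0"
proof -
  obtain s s' r where "second_order_response T D s s' r"
    using second_order_response_exists[OF assms(1)] .
  then interpret second_order_response T D s s' r .
  obtain \<rho> \<tau> \<sigma> where ret: "returns a x0 x1 \<rho>" "returns a y0 y1 \<tau>" "returns a z0 z1 \<sigma>"
    using half_return_returns x y z by metis
  show "a = 0 \<Longrightarrow> (y0 - x0) * (z1 - y1) - (y1 - x1) * (z0 - y0) = 0"
    and "a \<noteq> 0 \<Longrightarrow> T * ((y0 - x0) * (z1 - y1) - (y1 - x1) * (z0 - y0)) < 0"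
    using three_returns[OF ret assms(1) less] by auto
qed

lemma half_return_zero_ratio:
  assumes "T \<noteq> 0" "half_return T D 0 y0 y1 A" "half_return T D 0 z0 z1 B"
  obtains k where "0 < k" "0 < T * (k - 1)" "y1 = - k * y0" "z1 = - k * z0"
proof -
  obtain s s' r where "second_order_response T D s s' r"
    using second_order_response_exists[OF assms(1)] .
  then interpret second_order_response T D s s' r .
  show thesis
    by (rule half_return_returns[OF assms(2)], rule half_return_returns[OF assms(3)])
      (rule returns_zero_ratio[OF _ _ assms(1) that])
qed

section \<open>Right arcs and periodic orbits\<close>

text \<open>The central symmetry about \<open>(0, b/2)\<close> keeps \<open>T\<close>,
  \<open>D\<close> and the direction of time and replaces \<open>a\<close> by
  \<open>- a\<close>.\<close>

lemma orbit_arc_right_field: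
  assumes "orbit_arc (right_field T D a b) {p. fst p > 0} (0, y1) (0, y0) B"
  shows "orbit_arc (left_field T D (- a)) {p. fst p < 0} (0, b - y1) (0, b - y0)
    ((\<lambda>p. (- fst p, b - snd p)) ` B)"
proof -
  obtain \<phi> \<tau> where \<tau>: "\<tau> > 0"
    and d: "\<And>t. t \<in> {0..\<tau>} \<Longrightarrow>
      (\<phi> has_vector_derivative right_field T D a b (\<phi> t)) (at t within {0..\<tau>})"
    and ends: "\<phi> 0 = (0, y1)" "\<phi> \<tau> = (0, y0)"
    and pos: "\<And>t. t \<in> {0<..<\<tau>} \<Longrightarrow> fst (\<phi> t) > 0"
    and B: "B = \<phi> ` {0..\<tau>}"
    using assms unfolding orbit_arc_def mem_Collect_eq by blast
  let ?\<psi> = "\<lambda>t. (0, b) - \<phi> t"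
  have \<psi>: "?\<psi> t = (- fst (\<phi> t), b - snd (\<phi> t))" for t
    by (simp add: prod_eq_iff)
  have "(?\<psi> has_vector_derivative left_field T D (- a) (?\<psi> t)) (at t within {0..\<tau>})"
    if "t \<in> {0..\<tau>}" for t
  proof -
    have "(?\<psi> has_vector_derivative 0 - right_field T D a b (\<phi> t)) (at t within {0..\<tau>})"
      by (intro has_vector_derivative_diff has_vector_derivative_const d that)
    moreover have "0 - right_field T D a b (\<phi> t) = left_field T D (- a) (?\<psi> t)"
      by (simp add: right_field_def left_field_def prod_eq_iff)
    ultimately show ?thesis by simp
  qed
  moreover have "(\<lambda>p. (- fst p, b - snd p)) ` B = ?\<psi> ` {0..\<tau>}"
    unfolding B \<psi> by (simp add: image_image)
  ultimately show ?thesis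
    unfolding orbit_arc_def using \<tau> ends pos by (intro exI[of _ ?\<psi>] exI[of _ \<tau>]) auto
qed

lemma crossing_periodic_orbit_half_returns:
  assumes "crossing_periodic_orbit TL DL aL TR DR aR b C"
  obtains y0 y1 A B where "half_return TL DL aL y0 y1 A"
    "half_return TR DR (- aR) (b - y1) (b - y0) ((\<lambda>p. (- fst p, b - snd p)) ` B)" "C = A \<union> B"
proof -
  obtain y0 y1 A B where y: "max 0 b < y0" "y1 < min 0 b"
    and A: "orbit_arc (left_field TL DL aL) {p. fst p < 0} (0, y0) (0, y1) A"
    and B: "orbit_arc (right_field TR DR aR b) {p. fst p > 0} (0, y1) (0, y0) B"
    and C: "C = A \<union> B"
    using assms unfolding crossing_periodic_orbit_def by blast
  show thesis
    by (rule that[of y0 y1, OF _ _ C]) (use y A orbit_arc_right_field[OF B] in \<open>simp_all add: half_return_def\<close>)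
qed

text \<open>
  The determinant of \<open>half_return_three\<close> measures the bend of the graph at its middle point. It changes
  sign when both coordinates are swapped and reflected, which is what passing to the right arcs does.
\<close>

lemma no_three_crossings:
  assumes T: "TL * TR > 0" and less: "p0 < q0" "q0 < r0"
    and L: "half_return TL DL aL p0 p1 A" "half_return TL DL aL q0 q1 A'"
      "half_return TL DL aL r0 r1 A''"
    and R: "half_return TR DR aR (b - p1) (b - p0) B" "half_return TR DR aR (b - q1) (b - q0) B'"
      "half_return TR DR aR (b - r1) (b - r0) B''"
  shows False
proof -
  have TL: "TL \<noteq> 0" and TR: "TR \<noteq> 0" using T by auto
  \<comment> \<open>The reflected right arcs start at \<open>b - p1\<close>, \<open>b - q1\<close>,
    \<open>b - r1\<close>; as the left map decreases, these are again in increasing order.\<close>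
  have less': "b - p1 < b - q1" "b - q1 < b - r1"
    using half_return_decreasing[OF TL L(1,2) less(1)] half_return_decreasing[OF TL L(2,3) less(2)]
    by auto
  define d where "d = (q0 - p0) * (r1 - q1) - (q1 - p1) * (r0 - q0)"
  have "(b - q1 - (b - p1)) * (b - r0 - (b - q0)) - (b - q0 - (b - p0)) * (b - r1 - (b - q1)) = - d"
    by (simp add: d_def algebra_simps)
  note left = half_return_three[OF TL L less, folded d_def]
    and right = half_return_three[OF TR R less', unfolded this]
  show False
  proof (cases "aL = 0 \<and> aR = 0")
    case True
    then obtain k where k: "0 < k" "0 < TL * (k - 1)" "p1 = - k * p0" "q1 = - k * q0"
      using half_return_zero_ratio[OF TL] L by metis
    obtain k' where k': "0 < k'" "0 < TR * (k' - 1)" "b - p0 = - k' * (b - p1)"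
      "b - q0 = - k' * (b - q1)"
      using half_return_zero_ratio[OF TR] R True by metis
    \<comment> \<open>Subtracting the closing conditions of two orbits eliminates \<open>b\<close>
      and gives \<open>k' k = 1\<close>, although both ratios lie on the same side of 1.\<close>
    have "q0 - p0 = k' * (p1 - q1)" using k'(3,4) by (simp add: algebra_simps)
    also have "\<dots> = k' * k * (q0 - p0)" unfolding k by (simp add: algebra_simps)
    finally have "k' * k = 1" using less by simp
    moreover have "k > 1 \<and> k' > 1 \<or> k < 1 \<and> k' < 1"
      using k(2) k'(2) T by (auto simp: zero_less_mult_iff)
    ultimately show False
      using k(1) k'(1) mult_strict_mono[of 1 k' 1 k] mult_strict_mono[of k' 1 k 1] by auto
  next
    case False
    \<comment> \<open>If exactly one of \<open>aL\<close>, \<open>aR\<close> is 0, one side gives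
      \<open>d = 0\<close> and the other \<open>d \<noteq> 0\<close>. If neither is,
      \<open>TL d < 0 < TR d\<close> contradicts the equal signs of \<open>TL\<close> and
      \<open>TR\<close>.\<close>
    then show False
      using left right T by (cases "aL = 0"; cases "aR = 0") (auto simp: zero_less_mult_iff mult_less_0_iff)
  qed
qed

theorem corollary4:
  fixes TL DL aL TR DR aR b :: real
  assumes "aL\<^sup>2 + DL\<^sup>2 \<noteq> 0"
    and "aR\<^sup>2 + DR\<^sup>2 \<noteq> 0"
    and "TL * TR > 0"
  shows "finite {C. limit_cycle TL DL aL TR DR aR b C} \<and>
    card {C. limit_cycle TL DL aL TR DR aR b C} \<le> 2"
proof (rule ccontr)
  let ?S = "{C. limit_cycle TL DL aL TR DR aR b C}"
  let ?f = "\<lambda>p :: real \<times> real. (- fst p, b - snd p)"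
  assume "\<not> (finite ?S \<and> card ?S \<le> 2)"
  then obtain S where "S \<subseteq> ?S" "card S = 3"
    using obtain_subset_with_card_n[of 3 ?S] infinite_arbitrarily_large[of ?S 3]
    by (cases "finite ?S") auto
  then obtain C1 C2 C3 where C: "C1 \<noteq> C2" "C1 \<noteq> C3" "C2 \<noteq> C3"
    and po: "crossing_periodic_orbit TL DL aL TR DR aR b C1"
      "crossing_periodic_orbit TL DL aL TR DR aR b C2"
      "crossing_periodic_orbit TL DL aL TR DR aR b C3"
    unfolding card_3_iff by (auto simp: limit_cycle_def)
  have T: "TL \<noteq> 0" "TR \<noteq> 0" using assms(3) by auto
  define orb where "orb y0 y1 C \<longleftrightarrow> (\<exists>A B. half_return TL DL aL y0 y1 A \<and>
    half_return TR DR (- aR) (b - y1) (b - y0) (?f ` B) \<and> C = A \<union> B)" for y0 y1 C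
  have "inj ?f" by (auto simp: inj_def prod_eq_iff)
  \<comment> \<open>The upper crossing determines the orbit: it fixes the left arc and its end
    \<open>y1\<close>, which fixes the reflected right arc.\<close>
  then have unique: "C = C'" if orb: "orb y0 y1 C" "orb y0 y1' C'" for y0 y1 y1' C C'
  proof -
    obtain A B where A: "half_return TL DL aL y0 y1 A"
      "half_return TR DR (- aR) (b - y1) (b - y0) (?f ` B)" "C = A \<union> B"
      using orb(1) unfolding orb_def by blast
    obtain A' B' where A': "half_return TL DL aL y0 y1' A'"
      "half_return TR DR (- aR) (b - y1') (b - y0) (?f ` B')" "C' = A' \<union> B'"
      using orb(2) unfolding orb_def by blast
    have "y1' = y1" "A' = A" using half_return_unique[OF T(1) A'(1) A(1)] by auto
    moreover from this have "?f ` B' = ?f ` B"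
      using half_return_unique(2)[OF T(2) A(2)] A'(2) by simp
    then have "B' = B" using \<open>inj ?f\<close> by (simp only: inj_image_eq_iff)
    ultimately show ?thesis using A(3) A'(3) by simp
  qed
  have no_three: False if "orb p0 p1 C" "orb q0 q1 C'" "orb r0 r1 C''" "p0 < q0" "q0 < r0"
    for p0 p1 q0 q1 r0 r1 C C' C''
    using that unfolding orb_def by (elim exE conjE) (rule no_three_crossings[OF assms(3)])
  obtain x0 x1 where x: "orb x0 x1 C1"
    using crossing_periodic_orbit_half_returns[OF po(1)] unfolding orb_def by metis
  obtain y0 y1 where y: "orb y0 y1 C2"
    using crossing_periodic_orbit_half_returns[OF po(2)] unfolding orb_def by metis
  obtain z0 z1 where z: "orb z0 z1 C3"
    using crossing_periodic_orbit_half_returns[OF po(3)] unfolding orb_def by metis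
  \<comment> \<open>Distinct orbits thus have distinct upper crossings, and each of their six
    possible orders is excluded by \<open>no_three\<close>.\<close>
  have "x0 \<noteq> y0" "x0 \<noteq> z0" "y0 \<noteq> z0" using unique x y z C by blast+
  then consider "x0 < y0" "y0 < z0" | "x0 < z0" "z0 < y0" | "y0 < x0" "x0 < z0"
    | "y0 < z0" "z0 < x0" | "z0 < x0" "x0 < y0" | "z0 < y0" "y0 < x0"
    by linarith
  then show False
    by cases (rule no_three[OF x y z] no_three[OF x z y] no_three[OF y x z] no_three[OF y z x]
        no_three[OF z x y] no_three[OF z y x]; assumption)+
qed

end
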